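(* Let $G$ be an R1-reduced classical knot shadow with more than three crossings. A diagram on $G$ is a source if and only if: (1) the diagram is alternating; and (2) its marked Gauss word has no cyclic five-occurrence block $$\mathrm O_i\,\mathrm U_j\,\mathrm O_k\,\mathrm U_i\,\mathrm O_j$$ with $i,j,k$ pairwise distinct (that is, there are no five cyclically consecutive occurrences which are, in this order, an overcrossing occurrence of $i$, an undercrossing occurrence of $j$, an overcrossing occurrence of $k$, an undercrossing occurrence of $i$, and an overcrossing occurrence of $j$). In particular, there are at most two source diagrams on $G$.
   Context: Shadow. A classical knot shadow is the image $G\subset\mathbb R^2$ of a generic immersion $\gamma:S^1\to\mathbb R^2$ of a single circle whose only singularities are finitely many transverse double points, called crossings, denoted $x_0,\dots,x_{s-1}$ (crossing $x_i$ is also referred to by its label $i$). Each crossing has exactly two preimages in $S^1$, called its two occurrences. Orient $S^1$; reading the labels of the $2s$ occurrences in cyclic order, from a basepoint that is not an occurrence, gives the cyclic occurrence word (Gauss word) $W=w_0\cdots w_{2s-1}$, with positions read modulo $2s$, in which every label occurs twice. $G$ is R1-reduced if no two cyclically adjacent letters of $W$ are equal. Diagrams. A diagram on $G$ is a choice, for every crossing, of one of its two occurrences as the undercrossing occurrence (the other is the overcrossing occurrence). The marked Gauss word of the diagram is the cyclic word $W$ in which each occurrence is marked $\mathrm U$ if it is an undercrossing occurrence and $\mathrm O$ if it is an overcrossing occurrence; $\mathrm U_i$ (resp. $\mathrm O_i$) denotes the undercrossing (resp. overcrossing) occurrence of crossing $i$. The diagram is alternating if the marks $\mathrm U,\mathrm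 O$ alternate cyclically. Arc crossing change (Cericola's version). The $s$ undercrossing occurrences of a diagram cut the oriented circle $S^1$ into $s$ arcs, each running from one undercrossing occurrence to the next one in the cyclic order. An arc crossing change on an arc whose endpoints are the undercrossing occurrences of crossings $i$ and $j$ switches over/under at crossings $i$ and $j$ and leaves all other crossings unchanged. Source. A diagram on $G$ is a source if no other diagram on $G$ can be changed into it by one arc crossing change. *)

theory Defs
  imports "HOL-Analysis.Analysis"
begin

text \<open>
  The circle is \<^term>\<open>sphere 0 1 :: complex set\<close> with its counterclockwise orientation, so that
  \<open>t \<mapsto> cis t\<close> runs along it in the positive direction. The other orientation is obtained by
  replacing \<open>\<gamma>\<close> with \<open>\<gamma> \<circ> cnj\<close>. Values of \<open>\<gamma>\<close> off the circle are irrelevant.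
\<close>

definition shadow :: "(complex \<Rightarrow> real ^ 2) \<Rightarrow> (real ^ 2) set" where
  "shadow \<gamma> = \<gamma> ` sphere 0 1"

definition preimages :: "(complex \<Rightarrow> real ^ 2) \<Rightarrow> real ^ 2 \<Rightarrow> complex set" where
  "preimages \<gamma> y = {p \<in> sphere 0 1. \<gamma> p = y}"

definition velocity :: "(complex \<Rightarrow> real ^ 2) \<Rightarrow> real \<Rightarrow> real ^ 2" where
  "velocity \<gamma> t = vector_derivative (\<lambda>u. \<gamma> (cis u)) (at t)"

definition immersion :: "(complex \<Rightarrow> real ^ 2) \<Rightarrow> bool" where
  "immersion \<gamma> \<longleftrightarrow>
     (\<lambda>t. \<gamma> (cis t)) C1_differentiable_on UNIV \<and> (\<forall>t. velocity \<gamma> t \<noteq> 0)"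

definition crossings :: "(complex \<Rightarrow> real ^ 2) \<Rightarrow> (real ^ 2) set" where
  "crossings \<gamma> = {y \<in> shadow \<gamma>. \<exists>p\<in>preimages \<gamma> y. \<exists>q\<in>preimages \<gamma> y. p \<noteq> q}"

text \<open>The last conjunct is transversality: the two tangent lines at a crossing span the plane.\<close>

definition generic_immersion :: "(complex \<Rightarrow> real ^ 2) \<Rightarrow> bool" where
  "generic_immersion \<gamma> \<longleftrightarrow>
     immersion \<gamma> \<and>
     finite (crossings \<gamma>) \<and>
     (\<forall>y\<in>crossings \<gamma>. card (preimages \<gamma> y) = 2) \<and>
     (\<forall>t u. cis t \<noteq> cis u \<and> \<gamma> (cis t) = \<gamma> (cis u) \<longrightarrow>
        span {velocity \<gamma> t, velocity \<gamma> u} = UNIV)"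

definition occurrences :: "(complex \<Rightarrow> real ^ 2) \<Rightarrow> complex set" where
  "occurrences \<gamma> = {p \<in> sphere 0 1. \<gamma> p \<in> crossings \<gamma>}"

text \<open>A diagram is represented by the set of its undercrossing occurrences.\<close>

definition diagram :: "(complex \<Rightarrow> real ^ 2) \<Rightarrow> complex set \<Rightarrow> bool" where
  "diagram \<gamma> D \<longleftrightarrow>
     D \<subseteq> occurrences \<gamma> \<and> (\<forall>y\<in>crossings \<gamma>. \<exists>!p. p \<in> D \<and> \<gamma> p = y)"

text \<open>
  The arc of \<open>D\<close> from \<open>p\<close> to \<open>q\<close> in the positive direction; \<open>l = 2 * pi\<close> only matters for a diagram
  with a single crossing, whose only arc runs once around the circle.
\<close>

definition under_arc :: "complex set \<Rightarrow> complex \<Rightarrow> complex \<Rightarrow> bool" where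
  "under_arc D p q \<longleftrightarrow>
     p \<in> D \<and> q \<in> D \<and>
     (\<exists>a l. 0 < l \<and> l \<le> 2 * pi \<and> p = cis a \<and> q = cis (a + l) \<and>
        (\<forall>t. 0 < t \<and> t < l \<longrightarrow> cis (a + t) \<notin> D))"

definition switch_crossings ::
    "(complex \<Rightarrow> real ^ 2) \<Rightarrow> (real ^ 2) set \<Rightarrow> complex set \<Rightarrow> complex set" where
  "switch_crossings \<gamma> C D =
     {p \<in> occurrences \<gamma>. if \<gamma> p \<in> C then p \<notin> D else p \<in> D}"

definition arc_crossing_change ::
    "(complex \<Rightarrow> real ^ 2) \<Rightarrow> complex set \<Rightarrow> complex set \<Rightarrow> bool" where
  "arc_crossing_change \<gamma> D D' \<longleftrightarrow>
     (\<exists>p q. under_arc D p q \<and> D' = switch_crossings \<gamma> {\<gamma> p, \<gamma> q} D)"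

definition source :: "(complex \<Rightarrow> real ^ 2) \<Rightarrow> complex set \<Rightarrow> bool" where
  "source \<gamma> D \<longleftrightarrow>
     diagram \<gamma> D \<and> \<not> (\<exists>D'. diagram \<gamma> D' \<and> D' \<noteq> D \<and> arc_crossing_change \<gamma> D' D)"

text \<open>The occurrences in the order in which they are met when starting at the point \<open>cis b\<close>.\<close>

definition occurrence_list :: "(complex \<Rightarrow> real ^ 2) \<Rightarrow> real \<Rightarrow> complex list" where
  "occurrence_list \<gamma> b =
     map (\<lambda>t. cis (b + t))
       (sorted_list_of_set {t \<in> {0..<2 * pi}. cis (b + t) \<in> occurrences \<gamma>})"

text \<open>\<open>x 0, \<dots>, x (s - 1)\<close> is an enumeration of the crossings.\<close>

definition label :: "(complex \<Rightarrow> real ^ 2) \<Rightarrow> (nat \<Rightarrow> real ^ 2) \<Rightarrow> nat \<Rightarrow> complex \<Rightarrow> nat" where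
  "label \<gamma> x s p = the_inv_into {..<s} x (\<gamma> p)"

definition gauss_word ::
    "(complex \<Rightarrow> real ^ 2) \<Rightarrow> (nat \<Rightarrow> real ^ 2) \<Rightarrow> nat \<Rightarrow> real \<Rightarrow> nat list" where
  "gauss_word \<gamma> x s b = map (label \<gamma> x s) (occurrence_list \<gamma> b)"

datatype mark = Under | Over

definition marked_gauss_word ::
    "(complex \<Rightarrow> real ^ 2) \<Rightarrow> (nat \<Rightarrow> real ^ 2) \<Rightarrow> nat \<Rightarrow> real \<Rightarrow> complex set \<Rightarrow> (mark \<times> nat) list"
  where
  "marked_gauss_word \<gamma> x s b D =
     map (\<lambda>p. (if p \<in> D then Under else Over, label \<gamma> x s p)) (occurrence_list \<gamma> b)"

definition cyclic_nth :: "'a list \<Rightarrow> nat \<Rightarrow> 'a" where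
  "cyclic_nth w n = w ! (n mod length w)"

definition R1_reduced :: "nat list \<Rightarrow> bool" where
  "R1_reduced w \<longleftrightarrow> (\<forall>n<length w. cyclic_nth w n \<noteq> cyclic_nth w (n + 1))"

definition alternating :: "(mark \<times> nat) list \<Rightarrow> bool" where
  "alternating w \<longleftrightarrow> (\<forall>n<length w. fst (cyclic_nth w n) \<noteq> fst (cyclic_nth w (n + 1)))"

definition has_OUOUO_block :: "(mark \<times> nat) list \<Rightarrow> bool" where
  "has_OUOUO_block w \<longleftrightarrow>
     (\<exists>n<length w. \<exists>i j k. i \<noteq> j \<and> i \<noteq> k \<and> j \<noteq> k \<and>
        cyclic_nth w n = (Over, i) \<and>
        cyclic_nth w (n + 1) = (Under, j) \<and>
        cyclic_nth w (n + 2) = (Over, k) \<and>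
        cyclic_nth w (n + 3) = (Under, i) \<and>
        cyclic_nth w (n + 4) = (Over, j))"

end

theory Submission
  imports Defs
begin

text \<open>
  Let \<open>D\<close> arise from another diagram \<open>D'\<close> by an arc crossing change on an arc with end crossings
  \<open>i\<close> and \<open>j\<close>. The switch turns the two end points of the arc into overcrossing occurrences, and
  the only undercrossing occurrences of \<open>D\<close> that it can create inside the arc are those of \<open>i\<close> and
  \<open>j\<close> themselves. Conversely, if some segment of the word of \<open>D\<close> runs from \<open>O\<^sub>i\<close> to
  \<open>O\<^sub>j\<close> with \<open>i \<noteq> j\<close> and has no undercrossing occurrence in its interior except possibly
  \<open>U\<^sub>i\<close> and \<open>U\<^sub>j\<close>, then switching \<open>i\<close> and \<open>j\<close> makes this segment an arc of a diagram
  \<open>D'\<close>, and the arc crossing change on it leads back to \<open>D\<close>. So \<open>D\<close> is a source if and only if its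
  word has no such segment (lemma \<open>source_iff_no_switchable\<close>; the segments are the
  \<open>switchable\<close> pairs of positions).

  What remains is a statement about words (lemma \<open>no_switchable_iff\<close>). A diagram has as many
  over- as undercrossing occurrences, so if the marks do not alternate, then two \<open>O\<close> are adjacent
  somewhere, and they form such a segment with empty interior. If the marks do alternate, the segment
  has one, two or more undercrossing occurrences in its interior. More than two is impossible, because
  only \<open>U\<^sub>i\<close> and \<open>U\<^sub>j\<close> may occur. With one, this occurrence is adjacent to both ends and
  belongs to one of their crossings, against R1-reducedness. With two, R1-reducedness forces their order, and
  the segment is \<open>O\<^sub>i U\<^sub>j O\<^sub>k U\<^sub>i O\<^sub>j\<close>.

  There are at most two sources because an alternating diagram is determined by the mark of a single
  occurrence.
\<close>

section \<open>Diagrams on a cyclic word in which every label occurs twice\<close>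

text \<open>
  The cyclic word is unrolled into the sequence \<open>P\<close> of its occurrences, of period \<open>N\<close>, so that
  segments running past the basepoint are ordinary intervals of positions; \<open>g\<close> sends an occurrence
  to its crossing.
\<close>

locale double_occurrence_word =
  fixes P :: "nat \<Rightarrow> 'p" and N :: nat and g :: "'p \<Rightarrow> 'c"
  assumes N_pos: "N > 0"
    and P_eq_iff: "P m = P n \<longleftrightarrow> m mod N = n mod N"
    and two_occurrences: "q \<in> range P \<Longrightarrow> card {p \<in> range P. g p = g q} = 2"
begin

lemma P_mod [simp]: "P (n mod N) = P n"
  by (simp add: P_eq_iff)

lemma P_in_window:
  assumes "q \<in> range P"
  obtains k where "k < N" "q = P (m + k)"
proof -
  obtain n where n: "q = P n" using assms by auto
  have "\<exists>k<N. (m + k) mod N = n mod N"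
  proof (intro exI conjI)
    let ?k = "(n + (N - m mod N)) mod N"
    show "?k < N" using N_pos by simp
    have "(m + ?k) mod N = (m mod N + (n + (N - m mod N))) mod N"
      by (simp add: mod_simps)
    also have "m mod N + (n + (N - m mod N)) = n + N"
      using mod_less_divisor[OF N_pos, of m] by linarith
    finally show "(m + ?k) mod N = n mod N" by simp
  qed
  thus ?thesis using that n P_eq_iff by metis
qed

lemma P_neq:
  assumes "m < n" "n < m + N"
  shows "P m \<noteq> P n"
proof
  assume "P m = P n"
  hence "N dvd n - m"
    using assms by (metis P_eq_iff less_imp_le mod_eq_dvd_iff_nat)
  thus False using assms by (auto dest!: dvd_imp_le)
qed

lemma range_P_window: "range P = P ` {..<N}"
  using P_in_window[of _ 0] by auto

lemma inj_on_P: "inj_on P {..<N}"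
  by (auto simp: inj_on_def P_eq_iff)

lemma finite_range_P: "finite (range P)"
  by (simp add: range_P_window)

lemma card_range_P: "card (range P) = N"
  by (simp add: range_P_window card_image inj_on_P)

end

locale word_diagram = double_occurrence_word +
  fixes D :: "'a set"
  assumes D_sub: "D \<subseteq> range P"
    and unique_under: "q \<in> range P \<Longrightarrow> \<exists>!p. p \<in> D \<and> g p = g q"
begin

lemma under_eqI:
  assumes "p \<in> D" "q \<in> D" "g p = g q"
  shows "p = q"
  using assms unique_under D_sub by blast

text \<open>
  Together with the undercrossing occurrence of their crossing, different \<open>p\<close> and \<open>q\<close> would give it
  three occurrences.
\<close>

lemma over_eqI:
  assumes "p \<in> range P - D" "q \<in> range P - D" "g p = g q"
  shows "p = q"
proof (rule ccontr)
  assume "p \<noteq> q"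
  obtain u where u: "u \<in> D" "g u = g p"
    using unique_under assms(1) by blast
  have "{u, p, q} \<subseteq> {r \<in> range P. g r = g p}"
    using assms u D_sub by auto
  moreover have "card {u, p, q} = 3"
  proof -
    have "u \<noteq> p" "u \<noteq> q" using assms u by blast+
    thus ?thesis using \<open>p \<noteq> q\<close> by simp
  qed
  ultimately show False
    using two_occurrences[of p] assms(1) card_mono[of "{r \<in> range P. g r = g p}" "{u, p, q}"]
      finite_range_P by auto
qed

lemma over_exists:
  assumes "q \<in> range P"
  shows "\<exists>p \<in> range P - D. g p = g q"
proof (rule ccontr)
  assume "\<not> ?thesis"
  hence "{p \<in> range P. g p = g q} = {p. p \<in> D \<and> g p = g q}"
    using D_sub by auto
  moreover obtain u where "{p. p \<in> D \<and> g p = g q} = {u}"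
    using unique_under[OF assms] by (auto simp: set_eq_iff)
  ultimately show False using two_occurrences[OF assms] by simp
qed

lemma card_over: "card (range P - D) = card (g ` range P)"
proof -
  have "g ` range P \<subseteq> g ` (range P - D)"
  proof
    fix y assume "y \<in> g ` range P"
    then obtain q where "q \<in> range P" "y = g q" by auto
    thus "y \<in> g ` (range P - D)" using over_exists[of q] by (metis image_eqI)
  qed
  hence "g ` (range P - D) = g ` range P" by blast
  moreover have "inj_on g (range P - D)" using over_eqI by (auto simp: inj_on_def)
  ultimately show ?thesis by (metis card_image)
qed

lemma card_under: "card D = card (g ` range P)"
proof -
  have "g ` range P \<subseteq> g ` D"
  proof
    fix y assume "y \<in> g ` range P"
    then obtain q where "q \<in> range P" "y = g q" by auto
    thus "y \<in> g ` D" using unique_under[of q] by (metis image_eqI)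
  qed
  hence "g ` D = g ` range P" using D_sub by blast
  moreover have "inj_on g D" using under_eqI by (auto simp: inj_on_def)
  ultimately show ?thesis by (metis card_image)
qed

lemma N_eq: "N = 2 * card (g ` range P)"
proof -
  have "card (range P - D) = card (range P) - card D"
    using D_sub finite_range_P by (meson card_Diff_subset finite_subset)
  moreover have "card D \<le> card (range P)"
    using D_sub finite_range_P by (rule card_mono[rotated])
  ultimately show ?thesis using card_over card_under card_range_P by linarith
qed

definition alternates :: bool where
  "alternates \<longleftrightarrow> (\<forall>n. P n \<in> D \<longleftrightarrow> P (Suc n) \<notin> D)"

text \<open>
  A segment that becomes an arc when the crossings at its two ends are switched. The bound
  \<open>n < m + N\<close> makes the ends different occurrences; since both are overcrossing occurrences, they
  then belong to different crossings.
\<close>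

definition switchable :: "nat \<Rightarrow> nat \<Rightarrow> bool" where
  "switchable m n \<longleftrightarrow> m < n \<and> n < m + N \<and> P m \<notin> D \<and> P n \<notin> D \<and>
     (\<forall>j. m < j \<and> j < n \<and> P j \<in> D \<longrightarrow> g (P j) \<in> {g (P m), g (P n)})"

text \<open>
  The forbidden block starting at position \<open>m\<close>. The three crossings are distinct by the
  marks: for \<open>N > 4\<close> the positions \<open>m\<close>, \<open>m + 2\<close>, \<open>m + 4\<close> carry different overcrossing occurrences.
\<close>

definition block_at :: "nat \<Rightarrow> bool" where
  "block_at m \<longleftrightarrow> P m \<notin> D \<and> P (m + 1) \<in> D \<and> P (m + 2) \<notin> D \<and> P (m + 3) \<in> D \<and> P (m + 4) \<notin> D \<and>
     g (P (m + 1)) = g (P (m + 4)) \<and> g (P (m + 3)) = g (P m)"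

text \<open>
  If every overcrossing occurrence were followed by an undercrossing one, then the successor map would
  inject the overcrossing occurrences into the undercrossing ones. The two sets have the same
  cardinality, so this injection would be onto and the marks would alternate.
\<close>

lemma consecutive_overs:
  assumes "\<not> alternates"
  shows "\<exists>n. P n \<notin> D \<and> P (Suc n) \<notin> D"
proof (rule ccontr)
  assume no: "\<not> ?thesis"
  define f where "f j = Suc j mod N" for j
  define over under where "over = {j. j < N \<and> P j \<notin> D}" and "under = {j. j < N \<and> P j \<in> D}"
  have f: "P (f j) = P (Suc j)" for j by (simp add: f_def)
  have "inj_on f over"
  proof (rule inj_onI)
    fix j k assume *: "j \<in> over" "k \<in> over" "f j = f k"
    hence "j mod N = k mod N" unfolding f_def
      by (auto simp: mod_Suc split: if_splits)
    thus "j = k" using * by (simp add: over_def)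
  qed
  moreover have "f ` over \<subseteq> under"
    using no N_pos f by (auto simp: over_def under_def) (simp add: f_def)
  moreover have "card over = card under"
  proof -
    have "P ` over = range P - D" "P ` under = D"
      using range_P_window D_sub by (auto simp: over_def under_def)
    moreover have "inj_on P over" "inj_on P under"
      using inj_on_P by (auto simp: inj_on_def over_def under_def)
    ultimately show ?thesis using card_over card_under by (metis card_image)
  qed
  ultimately have surj: "f ` over = under"
    by (metis card_image card_subset_eq finite_Collect_conjI finite_Collect_less_nat under_def)
  have "P n \<notin> D" if "P (Suc n) \<in> D" for n
  proof -
    have "Suc n mod N \<in> under" using that N_pos by (simp add: under_def)
    then obtain j where j: "j \<in> over" "Suc j mod N = Suc n mod N"
      using surj by (auto simp: f_def)
    hence "j mod N = n mod N"
      by (auto simp: mod_Suc split: if_splits)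
    hence "P j = P n" by (simp add: P_eq_iff)
    thus ?thesis using j by (simp add: over_def)
  qed
  thus False using no assms unfolding alternates_def by blast
qed

lemma alternates_parity:
  assumes alternates
  shows "P (m + k) \<in> D \<longleftrightarrow> (P m \<in> D \<longleftrightarrow> even k)"
proof (induction k)
  case (Suc k)
  have "P (m + k) \<in> D \<longleftrightarrow> P (m + Suc k) \<notin> D"
    using assms unfolding alternates_def by (metis add_Suc_right)
  thus ?case using Suc by auto
qed simp

text \<open>
  Adjacent \<open>O\<close>s and forbidden blocks are themselves switchable segments. In the other direction, a
  switchable segment of an alternating diagram has even length \<open>k\<close>, and its interior contains the
  undercrossing occurrences at the odd offsets, which belong to different crossings among the two
  end crossings; hence \<open>k \<le> 4\<close>.
\<close>

lemma no_switchable_iff: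
  assumes reduced: "\<And>n. g (P n) \<noteq> g (P (Suc n))"
    and N: "N > 4"
  shows "(\<nexists>m n. switchable m n) \<longleftrightarrow> alternates \<and> (\<nexists>m. block_at m)"
proof
  assume none: "\<nexists>m n. switchable m n"
  have alternates
  proof (rule ccontr)
    assume "\<not> alternates"
    then obtain n where "P n \<notin> D" "P (Suc n) \<notin> D" using consecutive_overs by blast
    hence "switchable n (Suc n)" using N by (auto simp: switchable_def)
    thus False using none by blast
  qed
  moreover have "\<not> block_at m" for m
  proof
    assume b: "block_at m"
    have "g (P j) \<in> {g (P m), g (P (m + 4))}" if "m < j" "j < m + 4" "P j \<in> D" for j
    proof -
      have "j = m + 1 \<or> j = m + 2 \<or> j = m + 3" using that by linarith
      thus ?thesis using b that by (auto simp: block_at_def)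
    qed
    hence "switchable m (m + 4)" using b N by (simp add: switchable_def block_at_def)
    thus False using none by blast
  qed
  ultimately show "alternates \<and> (\<nexists>m. block_at m)" by blast
next
  assume R: "alternates \<and> (\<nexists>m. block_at m)"
  hence parity: "P (m + k) \<in> D \<longleftrightarrow> (P m \<in> D \<longleftrightarrow> even k)" for m k
    using alternates_parity by blast
  show "\<nexists>m n. switchable m n"
  proof (intro notI, elim exE)
    fix m n assume sw: "switchable m n"
    define k where "k = n - m"
    have n: "n = m + k" and k: "0 < k" "k < N" and m: "P m \<notin> D"
      using sw by (auto simp: k_def switchable_def)
    have "even k" using sw parity[of m k] by (auto simp: switchable_def n)
    have inner: "g (P (m + i)) \<in> {g (P m), g (P n)}" if "odd i" "i < k" for i
    proof -
      have "0 < i" using that by (auto intro: Nat.gr0I)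
      moreover have "P (m + i) \<in> D" using that m parity by simp
      ultimately show ?thesis using sw that by (auto simp: switchable_def n)
    qed
    have distinct: "g (P (m + i)) \<noteq> g (P (m + j))" if "odd i" "odd j" "i < j" "j < k" for i j
      using under_eqI[of "P (m + i)" "P (m + j)"] P_neq[of "m + i" "m + j"] parity m that k by auto
    obtain h where "k = 2 * h" using \<open>even k\<close> by (rule evenE)
    then consider "k = 2" | "k = 4" | "k \<ge> 6" using k(1) by force
    thus False
    proof cases
      case 1
      have "g (P (m + 1)) \<in> {g (P m), g (P (m + 2))}" using inner[of 1] 1 n by simp
      moreover have "g (P m) \<noteq> g (P (m + 1))" "g (P (m + 1)) \<noteq> g (P (m + 2))"
        using reduced[of m] reduced[of "m + 1"] by simp_all
      ultimately show False by auto
    next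
      case 2
      have "g (P (m + 1)) \<in> {g (P m), g (P (m + 4))}" "g (P (m + 3)) \<in> {g (P m), g (P (m + 4))}"
        using inner[of 1] inner[of 3] 2 n by simp_all
      moreover have "g (P m) \<noteq> g (P (m + 1))" "g (P (m + 3)) \<noteq> g (P (m + 4))"
        using reduced[of m] reduced[of "m + 3"] by (simp_all add: eval_nat_numeral)
      ultimately have "g (P (m + 1)) = g (P (m + 4))" "g (P (m + 3)) = g (P m)"
        by auto
      moreover have "P (m + 1) \<in> D" "P (m + 2) \<notin> D" "P (m + 3) \<in> D" "P (m + 4) \<notin> D"
        using m parity[of m 1] parity[of m 2] parity[of m 3] parity[of m 4] by simp_all
      ultimately have "block_at m" using m by (simp add: block_at_def)
      thus False using R by blast
    next
      case 3
      have "g (P (m + 1)) \<in> {g (P m), g (P n)}" "g (P (m + 3)) \<in> {g (P m), g (P n)}"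
        "g (P (m + 5)) \<in> {g (P m), g (P n)}"
        using inner[of 1] inner[of 3] inner[of 5] 3 by simp_all
      moreover have "g (P (m + 1)) \<noteq> g (P (m + 3))" "g (P (m + 1)) \<noteq> g (P (m + 5))"
        "g (P (m + 3)) \<noteq> g (P (m + 5))"
        using distinct[of 1 3] distinct[of 1 5] distinct[of 3 5] 3 by simp_all
      ultimately show False by auto
    qed
  qed
qed

end

section \<open>Occurrences along the circle\<close>

locale double_point_curve =
  fixes \<gamma> :: "complex \<Rightarrow> real ^ 2" and b :: real
  assumes finite_crossings: "finite (crossings \<gamma>)"
    and crossings_nonempty: "crossings \<gamma> \<noteq> {}"
    and card_preimages: "y \<in> crossings \<gamma> \<Longrightarrow> card (preimages \<gamma> y) = 2"
begin

definition times :: "real set" where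
  "times = {t \<in> {0..<2 * pi}. cis (b + t) \<in> occurrences \<gamma>}"

definition N :: nat where "N = card times"

definition P :: "nat \<Rightarrow> complex" where "P n = cyclic_nth (occurrence_list \<gamma> b) n"

text \<open>
  A lift of the cyclic sequence of occurrences to the real line, which lists all their
  angles from \<open>b\<close> on in increasing order, so that arcs of the circle become intervals of positions.
\<close>

definition angle :: "nat \<Rightarrow> real" where
  "angle n = b + sorted_list_of_set times ! (n mod N) + 2 * pi * real (n div N)"

lemma preimages_subset_occurrences:
  "y \<in> crossings \<gamma> \<Longrightarrow> preimages \<gamma> y \<subseteq> occurrences \<gamma>"
  by (auto simp: preimages_def occurrences_def)

lemma finite_occurrences: "finite (occurrences \<gamma>)"
proof -
  have "occurrences \<gamma> = (\<Union>y\<in>crossings \<gamma>. preimages \<gamma> y)"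
    by (auto simp: occurrences_def preimages_def)
  moreover have "finite (preimages \<gamma> y)" if "y \<in> crossings \<gamma>" for y
    using card_preimages[OF that] by (metis card.infinite zero_neq_numeral)
  ultimately show ?thesis using finite_crossings by simp
qed

lemma \<gamma>_occurrences: "\<gamma> ` occurrences \<gamma> = crossings \<gamma>"
proof
  show "crossings \<gamma> \<subseteq> \<gamma> ` occurrences \<gamma>"
  proof
    fix y assume y: "y \<in> crossings \<gamma>"
    then obtain p where "p \<in> preimages \<gamma> y" by (auto simp: crossings_def)
    hence "\<gamma> p = y" "p \<in> occurrences \<gamma>"
      using preimages_subset_occurrences[OF y] by (auto simp: preimages_def)
    thus "y \<in> \<gamma> ` occurrences \<gamma>" by blast
  qed
qed (auto simp: occurrences_def)

lemma cis_eq_iff: "cis t = cis u \<longleftrightarrow> (\<exists>k::int. t = u + 2 * pi * of_int k)"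
  using sin_cos_eq_iff[of t u] by (auto simp: complex_eq_iff)

lemma cis_add_period: "cis (t + 2 * pi * of_int k) = cis t"
  by (subst cis_eq_iff) blast

lemma inj_on_cis: "inj_on (\<lambda>t. cis (b + t)) {0..<2 * pi}"
proof (rule inj_onI)
  fix t u assume tu: "t \<in> {0..<2 * pi}" "u \<in> {0..<2 * pi}" "cis (b + t) = cis (b + u)"
  then obtain k :: int where k: "t = u + 2 * pi * of_int k" by (auto simp: cis_eq_iff)
  have "2 * pi * of_int k < 2 * pi * 1" "2 * pi * (-1) < 2 * pi * of_int k"
    using tu(1,2) k unfolding atLeastLessThan_iff by linarith+
  hence "of_int k < (1::real)" "-1 < (of_int k :: real)"
    using mult_less_cancel_left_pos[of "2 * pi"] by (metis pi_gt_zero zero_less_mult_iff zero_less_numeral)+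
  hence "k = 0" by linarith
  thus "t = u" using k by simp
qed

lemma finite_times: "finite times"
proof (rule finite_imageD)
  show "finite ((\<lambda>t. cis (b + t)) ` times)"
    by (rule finite_subset[OF _ finite_occurrences]) (auto simp: times_def)
  show "inj_on (\<lambda>t. cis (b + t)) times"
    by (rule inj_on_subset[OF inj_on_cis]) (auto simp: times_def)
qed

lemma turn_decomposition:
  obtains r :: real and k :: int where "t = b + r + 2 * pi * of_int k" "0 \<le> r" "r < 2 * pi"
proof -
  let ?k = "\<lfloor>(t - b) / (2 * pi)\<rfloor>"
  have "of_int ?k * (2 * pi) \<le> t - b" "t - b < (of_int ?k + 1) * (2 * pi)"
    by (rule floor_divide_lower floor_divide_upper; simp)+
  hence "0 \<le> t - b - 2 * pi * of_int ?k" "t - b - 2 * pi * of_int ?k < 2 * pi"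
    by (simp_all add: algebra_simps)
  thus ?thesis using that[of "t - b - 2 * pi * of_int ?k" ?k] by simp
qed

lemma cis_times: "(\<lambda>t. cis (b + t)) ` times = occurrences \<gamma>"
proof
  show "occurrences \<gamma> \<subseteq> (\<lambda>t. cis (b + t)) ` times"
  proof
    fix p assume p: "p \<in> occurrences \<gamma>"
    hence "norm p = 1" by (simp add: occurrences_def)
    hence "p = cis (Arg p)" by (metis rcis_cmod_Arg rcis_def of_real_1 mult_1)
    moreover obtain r k where r: "Arg p = b + r + 2 * pi * of_int k" "0 \<le> r" "r < 2 * pi"
      using turn_decomposition .
    ultimately have "p = cis (b + r)" using cis_add_period by metis
    thus "p \<in> (\<lambda>t. cis (b + t)) ` times" using r p by (auto simp: times_def)
  qed
qed (auto simp: times_def)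

lemma occurrence_list_times: "occurrence_list \<gamma> b = map (\<lambda>t. cis (b + t)) (sorted_list_of_set times)"
  by (simp add: occurrence_list_def times_def)

lemma length_occurrence_list: "length (occurrence_list \<gamma> b) = N"
  by (simp add: occurrence_list_times N_def)

lemma set_occurrence_list: "set (occurrence_list \<gamma> b) = occurrences \<gamma>"
  using cis_times by (simp add: occurrence_list_times finite_times)

lemma distinct_occurrence_list: "distinct (occurrence_list \<gamma> b)"
proof -
  have "inj_on (\<lambda>t. cis (b + t)) times"
    by (rule inj_on_subset[OF inj_on_cis]) (auto simp: times_def)
  thus ?thesis by (simp add: occurrence_list_times distinct_map finite_times)
qed

lemma N_pos: "N > 0"
proof -
  have "times \<noteq> {}" using cis_times \<gamma>_occurrences crossings_nonempty by auto
  thus ?thesis by (simp add: N_def card_gt_0_iff finite_times)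
qed

lemma P_eq_iff: "P m = P n \<longleftrightarrow> m mod N = n mod N"
  using distinct_occurrence_list N_pos
  by (simp add: P_def cyclic_nth_def length_occurrence_list nth_eq_iff_index_eq)

lemma range_P: "range P = occurrences \<gamma>"
proof
  show "range P \<subseteq> occurrences \<gamma>"
    using N_pos by (auto simp: P_def cyclic_nth_def length_occurrence_list
        simp flip: set_occurrence_list)
  show "occurrences \<gamma> \<subseteq> range P"
  proof
    fix p assume "p \<in> occurrences \<gamma>"
    then obtain n where "n < N" "p = occurrence_list \<gamma> b ! n"
      by (metis in_set_conv_nth length_occurrence_list set_occurrence_list)
    hence "p = P n" by (simp add: P_def cyclic_nth_def length_occurrence_list)
    thus "p \<in> range P" by blast
  qed
qed

lemma cis_angle: "cis (angle n) = P n"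
proof -
  have "cis (angle n) = cis (b + sorted_list_of_set times ! (n mod N))"
    using cis_add_period[of _ "int (n div N)"] by (simp add: angle_def)
  also have "\<dots> = P n"
    using N_pos by (simp add: P_def cyclic_nth_def length_occurrence_list)
      (simp add: occurrence_list_times N_def)
  finally show ?thesis .
qed

lemma nth_times:
  assumes "i < N"
  shows "sorted_list_of_set times ! i \<in> times"
  using assms finite_times nth_mem[of i "sorted_list_of_set times"] by (simp add: N_def)

lemma strict_mono_angle: "strict_mono angle"
proof (rule strict_mono_Suc_iff[THEN iffD2], rule allI)
  fix n
  let ?T = "sorted_list_of_set times"
  show "angle n < angle (Suc n)"
  proof (cases "Suc (n mod N) = N")
    case True
    hence eqs: "Suc n mod N = 0" "Suc n div N = Suc (n div N)"
      by (auto simp: mod_Suc div_Suc)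
    have "?T ! (n mod N) < 2 * pi" "0 \<le> ?T ! 0"
      using nth_times[of "n mod N"] nth_times[of 0] N_pos by (auto simp: times_def)
    thus ?thesis by (simp add: angle_def eqs algebra_simps)
  next
    case False
    hence eqs: "Suc n mod N = Suc (n mod N)" "Suc n div N = n div N"
      by (auto simp: mod_Suc div_Suc)
    have "Suc (n mod N) < N" using False N_pos mod_less_divisor[of N n] by linarith
    hence "?T ! (n mod N) < ?T ! (Suc (n mod N))"
      using strict_sorted_list_of_set[of times] by (simp add: N_def sorted_wrt_nth_less)
    thus ?thesis by (simp add: angle_def eqs)
  qed
qed

lemma angle_add_N: "angle (n + N) = angle n + 2 * pi"
  using N_pos by (simp add: angle_def algebra_simps)

lemma angle_surj:
  assumes "cis t \<in> occurrences \<gamma>" "b \<le> t"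
  obtains n where "t = angle n"
proof -
  obtain r k where r: "t = b + r + 2 * pi * of_int k" "0 \<le> r" "r < 2 * pi"
    using turn_decomposition .
  have "0 < 2 * pi * (of_int k + 1)" using r assms(2) by (simp add: algebra_simps)
  hence "0 < of_int k + (1::real)" by (simp add: zero_less_mult_iff)
  hence k: "0 \<le> k" by linarith
  have "cis (b + r) \<in> occurrences \<gamma>" using assms(1) r(1) cis_add_period by metis
  hence "r \<in> times" using r by (simp add: times_def)
  hence "r \<in> set (sorted_list_of_set times)" by (simp add: finite_times)
  then obtain i where i: "i < N" "r = sorted_list_of_set times ! i"
    by (metis N_def in_set_conv_nth length_sorted_list_of_set)
  have "t = angle (i + nat k * N)" unfolding angle_def using i k r(1) by simp
  thus ?thesis using that by blast
qed

lemma b_le_angle: "b \<le> angle n"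
  using nth_times[of "n mod N"] N_pos by (simp add: angle_def times_def)

text \<open>
  An arc may start at any representative \<open>a\<close> of the angle of its first point, in particular at
  \<open>angle m\<close>; by \<open>angle_surj\<close> its end point and the members of \<open>D\<close> met on the way are
  then among the later values of \<open>angle\<close>. The bound \<open>n \<le> m + N\<close> expresses that the arc
  makes at most one turn.
\<close>

lemma under_arc_iff:
  assumes "D \<subseteq> occurrences \<gamma>"
  shows "under_arc D p q \<longleftrightarrow>
    (\<exists>m n. m < n \<and> n \<le> m + N \<and> p = P m \<and> q = P n \<and> P m \<in> D \<and> P n \<in> D \<and>
       (\<forall>j. m < j \<and> j < n \<longrightarrow> P j \<notin> D))" (is "_ \<longleftrightarrow> ?R")
proof
  assume "under_arc D p q"
  then obtain a l where al: "p \<in> D" "q \<in> D" "0 < l" "l \<le> 2 * pi" "p = cis a" "q = cis (a + l)"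
    and free: "\<And>t. 0 < t \<Longrightarrow> t < l \<Longrightarrow> cis (a + t) \<notin> D"
    by (auto simp: under_arc_def)
  obtain m where m: "p = P m" using al(1) assms range_P by blast
  hence "cis (angle m) = cis a" using al(5) cis_angle by simp
  then obtain k where k: "angle m = a + 2 * pi * of_int k"
    by (auto simp: cis_eq_iff)
  have shift: "cis (angle m + t) = cis (a + t)" for t
    using cis_add_period[of "a + t" k] by (simp add: k algebra_simps)
  have "cis (angle m + l) \<in> occurrences \<gamma>" using al assms shift by auto
  moreover have "b \<le> angle m + l" using b_le_angle[of m] al(3) by linarith
  ultimately obtain n where n: "angle m + l = angle n" by (rule angle_surj)
  have "m < n" using n al(3) strict_mono_less[OF strict_mono_angle, of m n] by simp
  moreover have "n \<le> m + N"
    using n al(4) strict_mono_less_eq[OF strict_mono_angle, of n "m + N"] angle_add_N by simp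
  moreover have "q = P n" using shift[of l] al(6) cis_angle[of n] by (simp add: n)
  moreover have "P j \<notin> D" if "m < j" "j < n" for j
  proof -
    have "angle m < angle j" "angle j < angle n"
      using that strict_mono_angle by (auto simp: strict_mono_less)
    hence "cis (a + (angle j - angle m)) \<notin> D" using free n by simp
    thus ?thesis using shift[of "angle j - angle m"] cis_angle by simp
  qed
  ultimately show ?R using m al by blast
next
  assume ?R
  then obtain m n where mn: "m < n" "n \<le> m + N" "p = P m" "q = P n" "P m \<in> D" "P n \<in> D"
    and free: "\<And>j. m < j \<Longrightarrow> j < n \<Longrightarrow> P j \<notin> D" by blast
  have "angle m < angle n" "angle n \<le> angle m + 2 * pi"
    using strict_mono_less[OF strict_mono_angle, of m n]
      strict_mono_less_eq[OF strict_mono_angle, of n "m + N"] mn angle_add_N[of m] by simp_all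
  moreover have "cis (angle m + t) \<notin> D" if t: "0 < t" "t < angle n - angle m" for t
  proof
    assume in_D: "cis (angle m + t) \<in> D"
    hence "cis (angle m + t) \<in> occurrences \<gamma>" using assms by blast
    moreover have "b \<le> angle m + t" using b_le_angle[of m] t by linarith
    ultimately obtain j where j: "angle m + t = angle j" by (rule angle_surj)
    hence "m < j" "j < n"
      using t strict_mono_less[OF strict_mono_angle, of m j]
        strict_mono_less[OF strict_mono_angle, of j n] by linarith+
    moreover have "P j \<in> D" using in_D j cis_angle by simp
    ultimately show False using free by blast
  qed
  ultimately show "under_arc D p q"
    unfolding under_arc_def using mn cis_angle
    by (intro conjI exI[of _ "angle m"] exI[of _ "angle n - angle m"]) simp_all
qed

sublocale double_occurrence_word P N \<gamma>
proof
  fix q assume "q \<in> range P"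
  hence "\<gamma> q \<in> crossings \<gamma>" by (auto simp: range_P occurrences_def)
  moreover from this have "{p \<in> range P. \<gamma> p = \<gamma> q} = preimages \<gamma> (\<gamma> q)"
    by (auto simp: range_P occurrences_def preimages_def)
  ultimately show "card {p \<in> range P. \<gamma> p = \<gamma> q} = 2" using card_preimages by simp
qed (use N_pos P_eq_iff in auto)

section \<open>Sources\<close>

lemma word_diagram_iff: "word_diagram P N \<gamma> D \<longleftrightarrow> diagram \<gamma> D"
proof -
  have "(\<forall>q\<in>range P. \<exists>!p. p \<in> D \<and> \<gamma> p = \<gamma> q) \<longleftrightarrow> (\<forall>y\<in>crossings \<gamma>. \<exists>!p. p \<in> D \<and> \<gamma> p = y)"
    by (simp add: range_P flip: \<gamma>_occurrences)
  thus ?thesis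
    using double_occurrence_word_axioms
    by (auto simp: word_diagram_def word_diagram_axioms_def diagram_def range_P)
qed

lemma diagram_switch:
  assumes "diagram \<gamma> D"
  shows "diagram \<gamma> (switch_crossings \<gamma> C D)"
proof -
  interpret word_diagram P N \<gamma> D using assms word_diagram_iff by blast
  have "\<exists>!p. p \<in> switch_crossings \<gamma> C D \<and> \<gamma> p = y" if "y \<in> crossings \<gamma>" for y
  proof -
    have "y \<in> \<gamma> ` range P" using that by (simp add: range_P \<gamma>_occurrences)
    then obtain q where q: "q \<in> range P" "\<gamma> q = y" by (metis imageE)
    show ?thesis
    proof (cases "y \<in> C")
      case True
      have "p \<in> switch_crossings \<gamma> C D \<and> \<gamma> p = y \<longleftrightarrow> p \<in> range P - D \<and> \<gamma> p = \<gamma> q" for p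
        using True q by (auto simp: switch_crossings_def range_P)
      thus ?thesis using over_exists[OF q(1)] over_eqI by (metis (no_types, lifting))
    next
      case False
      have "p \<in> switch_crossings \<gamma> C D \<and> \<gamma> p = y \<longleftrightarrow> p \<in> D \<and> \<gamma> p = \<gamma> q" for p
        using False q D_sub by (auto simp: switch_crossings_def range_P)
      thus ?thesis using unique_under[OF q(1)] by simp
    qed
  qed
  thus ?thesis by (auto simp: diagram_def switch_crossings_def)
qed

lemma switch_switch:
  "D \<subseteq> occurrences \<gamma> \<Longrightarrow> switch_crossings \<gamma> C (switch_crossings \<gamma> C D) = D"
  by (auto simp: switch_crossings_def)

text \<open>
  Switching is an involution, so predecessors of \<open>D\<close> are obtained by switching two crossings of \<open>D\<close>;
  the claim says when this creates an arc between them. Two crossings are required because a diagram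
  with a single crossing has an arc from its undercrossing occurrence to itself, which corresponds to
  no pair of different positions.
\<close>

lemma source_iff_no_switchable:
  assumes D: "diagram \<gamma> D" and two: "card (crossings \<gamma>) \<ge> 2"
  shows "source \<gamma> D \<longleftrightarrow> (\<nexists>m n. word_diagram.switchable P N \<gamma> D m n)"
proof -
  interpret word_diagram P N \<gamma> D using D word_diagram_iff by blast
  have occ: "P j \<in> occurrences \<gamma>" for j using range_P by blast
  have "(\<exists>D'. diagram \<gamma> D' \<and> D' \<noteq> D \<and> arc_crossing_change \<gamma> D' D) \<longleftrightarrow> (\<exists>m n. switchable m n)"
  proof
    assume "\<exists>D'. diagram \<gamma> D' \<and> D' \<noteq> D \<and> arc_crossing_change \<gamma> D' D"
    then obtain D' p q where D': "diagram \<gamma> D'" "under_arc D' p q"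
      and DD': "D = switch_crossings \<gamma> {\<gamma> p, \<gamma> q} D'"
      by (auto simp: arc_crossing_change_def)
    interpret D': word_diagram P N \<gamma> D' using D' word_diagram_iff by blast
    obtain m n where mn: "m < n" "n \<le> m + N" "p = P m" "q = P n" "P m \<in> D'" "P n \<in> D'"
      and free: "\<And>j. m < j \<Longrightarrow> j < n \<Longrightarrow> P j \<notin> D'"
      using under_arc_iff[of D' p q] D'(2) D'.D_sub range_P by auto
    \<comment> \<open>An arc that closes up would contain the undercrossing occurrences of all crossings.\<close>
    have "n \<noteq> m + N"
    proof
      assume n: "n = m + N"
      have "D' \<subseteq> {P m}"
      proof
        fix r assume r: "r \<in> D'"
        hence "r \<in> range P" using D'.D_sub by blast
        then obtain k where "k < N" "r = P (m + k)" by (rule P_in_window)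
        thus "r \<in> {P m}" using free[of "m + k"] n r by (cases "k = 0") auto
      qed
      hence "card D' \<le> 1" using card_mono[of "{P m}" D'] by simp
      thus False using D'.card_under two by (simp add: range_P \<gamma>_occurrences)
    qed
    moreover have "P m \<notin> D" "P n \<notin> D" using mn by (auto simp: DD' switch_crossings_def)
    moreover have "\<gamma> (P j) \<in> {\<gamma> (P m), \<gamma> (P n)}" if "m < j" "j < n" "P j \<in> D" for j
      using that free[of j] mn unfolding DD' switch_crossings_def
      by (auto split: if_splits)
    ultimately show "\<exists>m n. switchable m n" using mn unfolding switchable_def
      by (metis le_neq_implies_less)
  next
    assume "\<exists>m n. switchable m n"
    then obtain m n where mn: "m < n" "n < m + N" "P m \<notin> D" "P n \<notin> D"
      and inner: "\<And>j. m < j \<Longrightarrow> j < n \<Longrightarrow> P j \<in> D \<Longrightarrow> \<gamma> (P j) \<in> {\<gamma> (P m), \<gamma> (P n)}"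
      unfolding switchable_def by blast
    define D' where "D' = switch_crossings \<gamma> {\<gamma> (P m), \<gamma> (P n)} D"
    have mem: "P m \<in> D'" "P n \<in> D'" using mn occ by (auto simp: D'_def switch_crossings_def)
    have "P j \<notin> D'" if j: "m < j" "j < n" for j
    proof
      assume "P j \<in> D'"
      hence "if \<gamma> (P j) \<in> {\<gamma> (P m), \<gamma> (P n)} then P j \<notin> D else P j \<in> D"
        unfolding D'_def switch_crossings_def by blast
      hence "P j \<notin> D" "\<gamma> (P j) = \<gamma> (P m) \<or> \<gamma> (P j) = \<gamma> (P n)"
        using inner[OF j] by (metis insert_iff empty_iff)+
      hence "P j = P m \<or> P j = P n"
        using over_eqI[of "P j" "P m"] over_eqI[of "P j" "P n"] mn by auto
      thus False using P_neq[of m j] P_neq[of j n] j mn by auto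
    qed
    moreover have "D' \<subseteq> occurrences \<gamma>" by (auto simp: D'_def switch_crossings_def)
    ultimately have "under_arc D' (P m) (P n)"
      using mn mem under_arc_iff[of D' "P m" "P n"] by (metis less_imp_le)
    moreover have "D = switch_crossings \<gamma> {\<gamma> (P m), \<gamma> (P n)} D'"
      using switch_switch D_sub by (simp add: D'_def range_P)
    ultimately have "arc_crossing_change \<gamma> D' D" unfolding arc_crossing_change_def by blast
    moreover have "diagram \<gamma> D'" unfolding D'_def using D by (rule diagram_switch)
    moreover have "D' \<noteq> D" using mem mn by blast
    ultimately show "\<exists>D'. diagram \<gamma> D' \<and> D' \<noteq> D \<and> arc_crossing_change \<gamma> D' D" by blast
  qed
  thus ?thesis using D by (simp add: source_def)
qed

lemma alternates_determined:
  assumes "diagram \<gamma> D" "diagram \<gamma> E"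
    and "word_diagram.alternates P D" "word_diagram.alternates P E"
    and "P 0 \<in> D \<longleftrightarrow> P 0 \<in> E"
  shows "D = E"
proof -
  interpret D: word_diagram P N \<gamma> D using assms word_diagram_iff by blast
  interpret E: word_diagram P N \<gamma> E using assms word_diagram_iff by blast
  have "P k \<in> D \<longleftrightarrow> P k \<in> E" for k
    using D.alternates_parity[of 0 k] E.alternates_parity[of 0 k] assms by simp
  thus ?thesis using D.D_sub E.D_sub by blast
qed

lemma cyclic_nth_map:
  "cyclic_nth (map f (occurrence_list \<gamma> b)) n = f (P n)"
  using N_pos by (simp add: cyclic_nth_def P_def length_occurrence_list)

lemma all_positions_iff:
  "(\<forall>n<N. Q (P n) (P (n + 1))) \<longleftrightarrow> (\<forall>n. Q (P n) (P (Suc n)))"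
proof (intro iffI allI)
  fix n assume *: "\<forall>n<N. Q (P n) (P (n + 1))"
  have "P (n mod N + 1) = P (Suc n)" by (simp add: P_eq_iff mod_simps)
  thus "Q (P n) (P (Suc n))" using * N_pos by (metis P_mod mod_less_divisor)
qed auto

end

lemma card_le_2_if_determined_by_bool:
  fixes f :: "'a \<Rightarrow> bool"
  assumes "inj_on f A"
  shows "finite A" "card A \<le> 2"
proof -
  show "finite A" using assms by (rule inj_on_finite[of f A UNIV]) auto
  show "card A \<le> 2" using card_inj_on_le[OF assms, of UNIV] by simp
qed

theorem theorem1p2:
  fixes \<gamma> :: "complex \<Rightarrow> real ^ 2" and x :: "nat \<Rightarrow> real ^ 2" and s :: nat and b :: real
  assumes "generic_immersion \<gamma>"
    and "bij_betw x {..<s} (crossings \<gamma>)"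
    and "cis b \<notin> occurrences \<gamma>"
    and "R1_reduced (gauss_word \<gamma> x s b)"
    and "s > 3"
  shows "(\<forall>D. diagram \<gamma> D \<longrightarrow>
            (source \<gamma> D \<longleftrightarrow>
               alternating (marked_gauss_word \<gamma> x s b D) \<and>
               \<not> has_OUOUO_block (marked_gauss_word \<gamma> x s b D))) \<and>
         finite {D. source \<gamma> D} \<and> card {D. source \<gamma> D} \<le> 2"
proof -
  have card_crossings: "card (crossings \<gamma>) = s" using bij_betw_same_card[OF assms(2)] by simp
  interpret double_point_curve \<gamma> b
    using assms(1,5) card_crossings by unfold_locales (auto simp: generic_immersion_def)
  have label_eq_iff: "label \<gamma> x s (P m) = label \<gamma> x s (P n) \<longleftrightarrow> \<gamma> (P m) = \<gamma> (P n)" for m n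
  proof -
    have "inj_on (the_inv_into {..<s} x) (crossings \<gamma>)"
      using bij_betw_the_inv_into[OF assms(2)] by (rule bij_betw_imp_inj_on)
    moreover have "\<gamma> (P i) \<in> crossings \<gamma>" for i using range_P \<gamma>_occurrences by blast
    ultimately show ?thesis by (simp add: label_def inj_on_eq_iff)
  qed
  have reduced: "\<gamma> (P n) \<noteq> \<gamma> (P (Suc n))" for n
    using assms(4) all_positions_iff[of "\<lambda>p q. label \<gamma> x s p \<noteq> label \<gamma> x s q"]
    by (simp add: R1_reduced_def gauss_word_def cyclic_nth_map length_occurrence_list label_eq_iff)
  have alternating_iff: "alternating (marked_gauss_word \<gamma> x s b D) \<longleftrightarrow> word_diagram.alternates P D"
    if "diagram \<gamma> D" for D
  proof -
    interpret word_diagram P N \<gamma> D using that word_diagram_iff by blast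
    show ?thesis
      using all_positions_iff[of "\<lambda>p q. p \<in> D \<longleftrightarrow> q \<notin> D"]
      by (simp add: alternating_def alternates_def marked_gauss_word_def cyclic_nth_map
          length_occurrence_list) (smt (verit) mark.distinct)
  qed
  have main: "source \<gamma> D \<longleftrightarrow> alternating (marked_gauss_word \<gamma> x s b D) \<and>
      \<not> has_OUOUO_block (marked_gauss_word \<gamma> x s b D)" if D: "diagram \<gamma> D" for D
  proof -
    interpret word_diagram P N \<gamma> D using D word_diagram_iff by blast
    have "N = 2 * s" using N_eq card_crossings by (simp add: range_P \<gamma>_occurrences)
    hence N: "N > 4" using assms(5) by simp
    have block_iff: "has_OUOUO_block (marked_gauss_word \<gamma> x s b D) \<longleftrightarrow> (\<exists>m. block_at m)"
    proof
      assume "has_OUOUO_block (marked_gauss_word \<gamma> x s b D)"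
      then obtain n i j k where w:
        "(if P n \<in> D then Under else Over, label \<gamma> x s (P n)) = (Over, i)"
        "(if P (n + 1) \<in> D then Under else Over, label \<gamma> x s (P (n + 1))) = (Under, j)"
        "(if P (n + 2) \<in> D then Under else Over, label \<gamma> x s (P (n + 2))) = (Over, k)"
        "(if P (n + 3) \<in> D then Under else Over, label \<gamma> x s (P (n + 3))) = (Under, i)"
        "(if P (n + 4) \<in> D then Under else Over, label \<gamma> x s (P (n + 4))) = (Over, j)"
        unfolding has_OUOUO_block_def marked_gauss_word_def cyclic_nth_map by blast
      have "P n \<notin> D" "P (n + 1) \<in> D" "P (n + 2) \<notin> D" "P (n + 3) \<in> D" "P (n + 4) \<notin> D"
        "label \<gamma> x s (P n) = i" "label \<gamma> x s (P (n + 1)) = j"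
        "label \<gamma> x s (P (n + 3)) = i" "label \<gamma> x s (P (n + 4)) = j"
        using w by (simp_all split: if_splits)
      hence "block_at n" unfolding block_at_def by (simp flip: label_eq_iff)
      thus "\<exists>m. block_at m" by blast
    next
      assume "\<exists>m. block_at m"
      then obtain m where m: "block_at m" by blast
      \<comment> \<open>A block of the word starts in the first period.\<close>
      define n where "n = m mod N"
      have "P (n + i) = P (m + i)" for i by (simp add: P_eq_iff n_def mod_simps)
      from this[of 0] this[of 1] this[of 2] this[of 3] this[of 4]
      have bn: "block_at n" using m by (simp add: block_at_def)
      have overs: "\<gamma> (P (n + i)) \<noteq> \<gamma> (P (n + j))"
        if "i < j" "j \<le> 4" "P (n + i) \<notin> D" "P (n + j) \<notin> D" for i j
        using over_eqI[of "P (n + i)" "P (n + j)"] P_neq[of "n + i" "n + j"] that N by auto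
      have "\<gamma> (P n) \<noteq> \<gamma> (P (n + 4))" "\<gamma> (P n) \<noteq> \<gamma> (P (n + 2))" "\<gamma> (P (n + 2)) \<noteq> \<gamma> (P (n + 4))"
        using overs[of 0 4] overs[of 0 2] overs[of 2 4] bn by (auto simp: block_at_def)
      hence "let i = label \<gamma> x s (P n); j = label \<gamma> x s (P (n + 4)); k = label \<gamma> x s (P (n + 2))
        in i \<noteq> j \<and> i \<noteq> k \<and> j \<noteq> k"
        by (auto simp: label_eq_iff Let_def)
      moreover have "label \<gamma> x s (P (n + 1)) = label \<gamma> x s (P (n + 4))"
        "label \<gamma> x s (P (n + 3)) = label \<gamma> x s (P n)"
        using bn by (auto simp: label_eq_iff block_at_def)
      moreover have "n < N" using N_pos by (simp add: n_def)
      ultimately show "has_OUOUO_block (marked_gauss_word \<gamma> x s b D)"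
        unfolding has_OUOUO_block_def marked_gauss_word_def cyclic_nth_map
        using bn by (intro exI[of _ n]) (simp add: block_at_def Let_def length_occurrence_list)
    qed
    show ?thesis
      using source_iff_no_switchable[OF D] no_switchable_iff[OF reduced N]
        alternating_iff[OF D] block_iff card_crossings assms(5) by simp
  qed
  have "inj_on (\<lambda>D. P 0 \<in> D) {D. source \<gamma> D}"
  proof (rule inj_onI)
    fix D E assume *: "D \<in> {D. source \<gamma> D}" "E \<in> {D. source \<gamma> D}" "(P 0 \<in> D) = (P 0 \<in> E)"
    hence "diagram \<gamma> D" "diagram \<gamma> E" by (auto simp: source_def)
    thus "D = E" using * main alternating_iff alternates_determined by blast
  qed
  thus ?thesis using main card_le_2_if_determined_by_bool by blast
qed

end
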